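(* There exists a polynomial-time algorithm that, given any $n$-vertex unweighted undirected graph $G=(V,E)$ and a source vertex $s\in V$, constructs a 1-edge $(3,0)$ FT-ABFS structure $H\subseteq G$ with respect to $s$ having $O(n)$ edges. That is, $H$ is a spanning subgraph of $G$ with $|E(H)|=O(n)$ such that for every vertex $v\in V$ and every edge $e\in E$, $$\mathrm{dist}(s,v,H\setminus\{e\})\le 3\cdot \mathrm{dist}(s,v,G\setminus\{e\}).$$
   Context: For a graph $G'$ and vertices $u,v$, $\mathrm{dist}(u,v,G')$ denotes the number of edges on a shortest $u$–$v$ path in $G'$ (infinite if none exists). For a set $F$ of edges, $G\setminus F$ is the graph obtained by deleting the edges of $F$. Given an unweighted undirected graph $G=(V,E)$ and source $s\in V$, a spanning subgraph $H\subseteq G$ is an $f$-edge $(\alpha,\beta)$ FT-ABFS structure with respect to $s$ if for every $v\in V$ and every $F\subseteq E$ with $|F|\le f$, $\mathrm{dist}(s,v,H\setminus F)\le \alpha\cdot\mathrm{dist}(s,v,G\setminus F)+\beta$. *)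

theory Defs
  imports "HOL-Library.Extended_Real" "HOL-Computational_Algebra.Polynomial"
begin

section \<open>Graphs, distances and fault-tolerant approximate BFS structures\<close>

definition simple_graph :: "'a set \<Rightarrow> 'a set set \<Rightarrow> bool" where
  "simple_graph V E \<longleftrightarrow>
     finite V \<and> (\<forall>e\<in>E. \<exists>u v. u \<in> V \<and> v \<in> V \<and> u \<noteq> v \<and> e = {u, v})"

definition is_path :: "'a set set \<Rightarrow> 'a \<Rightarrow> 'a list \<Rightarrow> 'a \<Rightarrow> bool" where
  "is_path E u p v \<longleftrightarrow>
     p \<noteq> [] \<and> hd p = u \<and> last p = v \<and> distinct p \<and>
     successively (\<lambda>x y. {x, y} \<in> E) p"

text \<open>If there is no path, the infimum is over the empty set, hence \<open>\<infinity>\<close>.\<close>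

definition gdist :: "'a \<Rightarrow> 'a \<Rightarrow> 'a set set \<Rightarrow> enat" where
  "gdist u v E = (INF p \<in> {p. is_path E u p v}. enat (length p - 1))"

text \<open>A spanning subgraph of \<open>(V, E)\<close> has vertex set \<open>V\<close> and is given by its edge set \<open>H \<subseteq> E\<close>.\<close>

definition ft_abfs ::
    "nat \<Rightarrow> real \<Rightarrow> real \<Rightarrow> 'a set \<Rightarrow> 'a set set \<Rightarrow> 'a \<Rightarrow> 'a set set \<Rightarrow> bool" where
  "ft_abfs f \<alpha> \<beta> V E s H \<longleftrightarrow>
     H \<subseteq> E \<and>
     (\<forall>v\<in>V. \<forall>F. F \<subseteq> E \<and> finite F \<and> card F \<le> f \<longrightarrow>
        ereal_of_enat (gdist s v (H - F))
          \<le> ereal \<alpha> * ereal_of_enat (gdist s v (E - F)) + ereal \<beta>)"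

section \<open>Model of computation\<close>

text \<open>
  Algorithms are programs of a structured random access machine with uniform cost. The memory
  consists of arrays of natural numbers (a scalar is cell 0 of an array); a program mentions only
  finitely many of them. The arithmetic is addition and truncated subtraction. Multiplication is
  deliberately absent: a step increases the bit length of the largest stored number by at most a
  constant depending on the program, so polynomially many steps can be simulated by a Turing
  machine in polynomial time. Charging one unit for an assignment or a test is adequate because
  the expressions of a fixed program have bounded size.
\<close>

type_synonym vname = string
type_synonym state = "vname \<Rightarrow> nat \<Rightarrow> nat"

datatype aexp = N nat | Cell vname aexp | Plus aexp aexp | Minus aexp aexp

datatype bexp = Less aexp aexp | Not bexp | And bexp bexp

datatype com =
    SKIP
  | Assign vname aexp aexp  \<comment> \<open>array, index, value\<close>
  | Seq com com
  | If bexp com com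
  | While bexp com

fun aval :: "aexp \<Rightarrow> state \<Rightarrow> nat" where
  "aval (N k) \<sigma> = k"
| "aval (Cell x a) \<sigma> = \<sigma> x (aval a \<sigma>)"
| "aval (Plus a b) \<sigma> = aval a \<sigma> + aval b \<sigma>"
| "aval (Minus a b) \<sigma> = aval a \<sigma> - aval b \<sigma>"

fun bval :: "bexp \<Rightarrow> state \<Rightarrow> bool" where
  "bval (Less a b) \<sigma> \<longleftrightarrow> aval a \<sigma> < aval b \<sigma>"
| "bval (Not b) \<sigma> \<longleftrightarrow> \<not> bval b \<sigma>"
| "bval (And b c) \<sigma> \<longleftrightarrow> bval b \<sigma> \<and> bval c \<sigma>"

text \<open>\<open>exec c \<sigma> t \<sigma>'\<close>: started in \<open>\<sigma>\<close>, the program \<open>c\<close> halts after \<open>t\<close> steps in \<open>\<sigma>'\<close>.\<close>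

inductive exec :: "com \<Rightarrow> state \<Rightarrow> nat \<Rightarrow> state \<Rightarrow> bool" where
  Skip: "exec SKIP \<sigma> 1 \<sigma>"
| Assign: "exec (Assign x a b) \<sigma> 1 (\<sigma>(x := (\<sigma> x)(aval a \<sigma> := aval b \<sigma>)))"
| Seq: "exec c \<sigma> t1 \<sigma>' \<Longrightarrow> exec d \<sigma>' t2 \<sigma>'' \<Longrightarrow> exec (Seq c d) \<sigma> (t1 + t2) \<sigma>''"
| IfTrue: "bval b \<sigma> \<Longrightarrow> exec c \<sigma> t \<sigma>' \<Longrightarrow> exec (If b c d) \<sigma> (t + 1) \<sigma>'"
| IfFalse: "\<not> bval b \<sigma> \<Longrightarrow> exec d \<sigma> t \<sigma>' \<Longrightarrow> exec (If b c d) \<sigma> (t + 1) \<sigma>'"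
| WhileFalse: "\<not> bval b \<sigma> \<Longrightarrow> exec (While b c) \<sigma> 1 \<sigma>"
| WhileTrue: "bval b \<sigma> \<Longrightarrow> exec c \<sigma> t1 \<sigma>' \<Longrightarrow> exec (While b c) \<sigma>' t2 \<sigma>'' \<Longrightarrow>
    exec (While b c) \<sigma> (t1 + t2 + 1) \<sigma>''"

text \<open>Execution is deterministic, so the existence of a run within a time bound determines the
  behaviour of a program.\<close>

lemma exec_determ:
  "exec c \<sigma> t \<tau> \<Longrightarrow> exec c \<sigma> t' \<tau>' \<Longrightarrow> t' = t \<and> \<tau>' = \<tau>"
proof (induction arbitrary: t' \<tau>' rule: exec.induct)
  case Skip
  from Skip.prems show ?case by cases simp
next
  case Assign
  from Assign.prems show ?case by cases simp
next
  case Seq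
  from Seq.prems show ?case by cases (auto dest!: Seq.IH)
next
  case IfTrue
  from IfTrue.prems show ?case by cases (use IfTrue.hyps in \<open>auto dest!: IfTrue.IH\<close>)
next
  case IfFalse
  from IfFalse.prems show ?case by cases (use IfFalse.hyps in \<open>auto dest!: IfFalse.IH\<close>)
next
  case WhileFalse
  from WhileFalse.prems show ?case by cases (use WhileFalse.hyps in auto)
next
  case WhileTrue
  from WhileTrue.prems show ?case by cases (use WhileTrue.hyps in \<open>auto dest!: WhileTrue.IH\<close>)
qed

section \<open>Input and output encoding\<close>

text \<open>
  An \<open>n\<close>-vertex graph is presented to an algorithm by its 0/1 adjacency matrix, stored row by row;
  its vertices are thereby numbered \<open>0, \<dots>, n - 1\<close>.
\<close>

definition adj_array :: "nat \<Rightarrow> nat set set \<Rightarrow> nat \<Rightarrow> nat" where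
  "adj_array n E i = of_bool (i < n * n \<and> {i div n, i mod n} \<in> E)"

definition graph_input :: "nat \<Rightarrow> nat set set \<Rightarrow> nat \<Rightarrow> state" where
  "graph_input n E s =
     (\<lambda>_ _. 0)(''n'' := (\<lambda>_. 0)(0 := n), ''s'' := (\<lambda>_. 0)(0 := s), ''adj'' := adj_array n E)"

definition outputs_graph :: "state \<Rightarrow> nat \<Rightarrow> nat set set \<Rightarrow> bool" where
  "outputs_graph \<sigma> n H \<longleftrightarrow> (\<forall>i < n * n. \<sigma> ''out'' i = adj_array n H i)"

end

theory Submission
  imports Defs
begin

text \<open>
  Let \<open>T\<close> be a BFS tree with depth function \<open>d\<close> and parent function \<open>p\<close>. The structure consists of
  \<open>T\<close> and, for every vertex \<open>y \<noteq> s\<close>, one swap edge for the failure of \<open>{p y, y}\<close>: among the edges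
  \<open>{a, b}\<close> of \<open>G\<close> other than \<open>{p y, y}\<close> with \<open>b\<close> but not \<open>a\<close> in the subtree of \<open>y\<close>, one minimising
  \<open>d a + d b\<close>. Suppose that \<open>{p y, y}\<close> fails and \<open>v\<close> lies in the subtree of \<open>y\<close>. A replacement path of
  length \<open>L\<close> enters the subtree by some such edge, so \<open>d a + d b + 1 \<le> L + d v\<close> for that edge and hence
  for the chosen one. The walk along \<open>T\<close> from \<open>s\<close> to \<open>a\<close>, across \<open>{a, b}\<close>, up to \<open>y\<close> and down to \<open>v\<close>
  then has length \<open>d a + 1 + (d b - d y) + (d v - d y) \<le> L + 2 * (d v - d y) \<le> 3 * L\<close>.

  The algorithm is written with loops over \<open>{0..<n}\<close> as the only form of iteration, which makes
  its running time polynomial for syntactic reasons, so that its correctness can be treated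
  separately, for a denotational semantics.
\<close>

section \<open>Programs with bounded loops\<close>

datatype prog =
    PAssign vname aexp aexp
  | PSeq prog prog
  | PWhen bexp prog
  | PFor vname prog

abbreviation upd :: "state \<Rightarrow> vname \<Rightarrow> nat \<Rightarrow> nat \<Rightarrow> state" where
  "upd \<sigma> x i k \<equiv> \<sigma>(x := (\<sigma> x)(i := k))"

primrec compile :: "prog \<Rightarrow> com" where
  "compile (PAssign x a b) = Assign x a b"
| "compile (PSeq c d) = Seq (compile c) (compile d)"
| "compile (PWhen b c) = If b (compile c) SKIP"
| "compile (PFor x c) =
     Seq (Assign x (N 0) (N 0))
       (While (Less (Cell x (N 0)) (Cell ''n'' (N 0)))
         (Seq (compile c) (Assign x (N 0) (Plus (Cell x (N 0)) (N 1)))))"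

text \<open>The loop bound is read once and the counter ends at \<open>n\<close>, as after the
  compiled loop. The machine rereads both cells at every test; \<open>loops_ok\<close> makes the two
  views agree.\<close>

primrec sem :: "prog \<Rightarrow> state \<Rightarrow> state" where
  "sem (PAssign x a b) = (\<lambda>\<sigma>. upd \<sigma> x (aval a \<sigma>) (aval b \<sigma>))"
| "sem (PSeq c d) = (\<lambda>\<sigma>. sem d (sem c \<sigma>))"
| "sem (PWhen b c) = (\<lambda>\<sigma>. if bval b \<sigma> then sem c \<sigma> else \<sigma>)"
| "sem (PFor x c) = (\<lambda>\<sigma>. let n = \<sigma> ''n'' 0 in
     upd (fold (\<lambda>i \<tau>. sem c (upd \<tau> x 0 i)) [0..<n] \<sigma>) x 0 n)"

primrec writes :: "prog \<Rightarrow> vname set" where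
  "writes (PAssign x a b) = {x}"
| "writes (PSeq c d) = writes c \<union> writes d"
| "writes (PWhen b c) = writes c"
| "writes (PFor x c) = insert x (writes c)"

primrec loops_ok :: "prog \<Rightarrow> bool" where
  "loops_ok (PAssign x a b) \<longleftrightarrow> x \<noteq> ''n''"
| "loops_ok (PSeq c d) \<longleftrightarrow> loops_ok c \<and> loops_ok d"
| "loops_ok (PWhen b c) \<longleftrightarrow> loops_ok c"
| "loops_ok (PFor x c) \<longleftrightarrow> x \<noteq> ''n'' \<and> x \<notin> writes c \<and> loops_ok c"

text \<open>\<open>[:0, 1:]\<close> is the monomial standing for \<open>n\<close>. Each round adds a
  test and an increment to the body; the last \<open>2\<close> pays for the initial assignment and
  the failing test.\<close>

primrec time_poly :: "prog \<Rightarrow> nat poly" where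
  "time_poly (PAssign x a b) = 1"
| "time_poly (PSeq c d) = time_poly c + time_poly d"
| "time_poly (PWhen b c) = time_poly c + 2"
| "time_poly (PFor x c) = [:0, 1:] * (time_poly c + 2) + 2"

lemma sem_frame: "z \<notin> writes c \<Longrightarrow> sem c \<sigma> z = \<sigma> z"
proof (induction c arbitrary: \<sigma>)
  case (PFor x c)
  have "fold (\<lambda>i \<tau>. sem c (upd \<tau> x 0 i)) is \<sigma> z = \<sigma> z" for "is"
    using PFor by (induction "is" rule: rev_induct) auto
  with PFor.prems show ?case by (simp add: Let_def)
qed auto

lemma loops_ok_writes: "loops_ok c \<Longrightarrow> ''n'' \<notin> writes c"
  by (induction c) auto

text \<open>The loop counter is not part of the accumulated state \<open>\<tau>\<close>: each iteration
  overwrites it, which is why the run starts in \<open>upd \<tau> x 0 i\<close>.\<close>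

lemma exec_for_loop:
  assumes body: "\<And>\<tau>. \<tau> ''n'' 0 = n \<Longrightarrow> \<exists>t\<le>T. exec c \<tau> t (f \<tau>)"
    and frame: "\<And>\<tau>. f \<tau> x = \<tau> x" "\<And>\<tau>. f \<tau> ''n'' = \<tau> ''n''"
    and x: "x \<noteq> ''n''" and "\<tau> ''n'' 0 = n" "i \<le> n"
  shows "\<exists>t\<le>(n - i) * (T + 2) + 1.
    exec (While (Less (Cell x (N 0)) (Cell ''n'' (N 0)))
           (Seq c (Assign x (N 0) (Plus (Cell x (N 0)) (N 1)))))
      (upd \<tau> x 0 i) t (upd (fold (\<lambda>i \<tau>. f (upd \<tau> x 0 i)) [i..<n] \<tau>) x 0 n)"
  using assms(5,6)
proof (induction "n - i" arbitrary: i \<tau>)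
  case 0
  hence i: "i = n" by simp
  moreover have "exec (While (Less (Cell x (N 0)) (Cell ''n'' (N 0)))
           (Seq c (Assign x (N 0) (Plus (Cell x (N 0)) (N 1)))))
      (upd \<tau> x 0 n) 1 (upd \<tau> x 0 n)"
    using 0 x by (intro exec.WhileFalse) simp
  ultimately show ?case unfolding i by (intro exI[of _ 1]) (simp del: fun_upd_apply)
next
  case (Suc m)
  hence i: "i < n" by simp
  let ?\<tau> = "upd \<tau> x 0 i"
  have n: "?\<tau> ''n'' 0 = n" using Suc.prems x by simp
  obtain t where t: "t \<le> T" "exec c ?\<tau> t (f ?\<tau>)" using body[of ?\<tau>, OF n] by blast
  have fx: "f ?\<tau> x 0 = i" "f ?\<tau> ''n'' 0 = n" using frame n by simp_all
  have inc: "exec (Assign x (N 0) (Plus (Cell x (N 0)) (N 1))) (f ?\<tau>) 1 (upd (f ?\<tau>) x 0 (Suc i))"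
    using exec.Assign[of x "N 0" "Plus (Cell x (N 0)) (N 1)" "f ?\<tau>"] fx by simp
  have "m = n - Suc i" "Suc i \<le> n" using Suc.hyps i by simp_all
  from Suc.hyps(1)[where \<tau> = "f ?\<tau>", OF this(1) fx(2) this(2)] obtain t' where
    t': "t' \<le> (n - Suc i) * (T + 2) + 1"
      "exec (While (Less (Cell x (N 0)) (Cell ''n'' (N 0)))
           (Seq c (Assign x (N 0) (Plus (Cell x (N 0)) (N 1)))))
      (upd (f ?\<tau>) x 0 (Suc i)) t' (upd (fold (\<lambda>i \<tau>. f (upd \<tau> x 0 i)) [Suc i..<n] (f ?\<tau>)) x 0 n)"
    by blast
  have "bval (Less (Cell x (N 0)) (Cell ''n'' (N 0))) ?\<tau>"
    using i n by simp
  from exec.WhileTrue[OF this exec.Seq[OF t(2) inc] t'(2)]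
  have "exec (While (Less (Cell x (N 0)) (Cell ''n'' (N 0)))
           (Seq c (Assign x (N 0) (Plus (Cell x (N 0)) (N 1)))))
      ?\<tau> (t + 1 + t' + 1) (upd (fold (\<lambda>i \<tau>. f (upd \<tau> x 0 i)) [i..<n] \<tau>) x 0 n)"
    using i by (simp add: upt_conv_Cons)
  moreover have "n - i = Suc (n - Suc i)" using i by simp
  hence "t + 1 + t' + 1 \<le> (n - i) * (T + 2) + 1" using t(1) t'(1) by simp
  ultimately show ?case by blast
qed

text \<open>By structural induction: a loop multiplies the bound of its body by the value of
  \<open>n\<close>, which no program satisfying \<open>loops_ok\<close> changes.\<close>

lemma exec_compile:
  assumes "loops_ok c" "\<sigma> ''n'' 0 = n"
  shows "\<exists>t\<le>poly (time_poly c) n. exec (compile c) \<sigma> t (sem c \<sigma>)"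
  using assms
proof (induction c arbitrary: \<sigma>)
  case (PAssign x a b)
  show ?case using exec.Assign[of x a b \<sigma>] by (intro exI[of _ 1]) (simp del: fun_upd_apply)
next
  case (PSeq c d)
  have "sem c \<sigma> ''n'' 0 = n" using PSeq.prems sem_frame loops_ok_writes by simp
  with PSeq obtain t1 t2 where "t1 \<le> poly (time_poly c) n" "exec (compile c) \<sigma> t1 (sem c \<sigma>)"
    "t2 \<le> poly (time_poly d) n" "exec (compile d) (sem c \<sigma>) t2 (sem d (sem c \<sigma>))"
    by (metis loops_ok.simps(2))
  then show ?case by (auto intro!: exI[of _ "t1 + t2"] exec.Seq)
next
  case (PWhen b c)
  then obtain t where t: "t \<le> poly (time_poly c) n" "exec (compile c) \<sigma> t (sem c \<sigma>)" by auto
  show ?case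
  proof (cases "bval b \<sigma>")
    case True
    with t show ?thesis by (auto intro!: exI[of _ "t + 1"] exec.IfTrue)
  next
    case False
    with exec.IfFalse[OF _ exec.Skip] show ?thesis by (auto intro!: exI[of _ "1 + 1"])
  qed
next
  case (PFor x c)
  let ?T = "poly (time_poly c) n"
  from PFor.prems have ok: "x \<noteq> ''n''" "x \<notin> writes c" "loops_ok c" "''n'' \<notin> writes c"
    using loops_ok_writes by auto
  have "\<exists>t\<le>(n - 0) * (?T + 2) + 1.
    exec (While (Less (Cell x (N 0)) (Cell ''n'' (N 0)))
           (Seq (compile c) (Assign x (N 0) (Plus (Cell x (N 0)) (N 1)))))
      (upd \<sigma> x 0 0) t (upd (fold (\<lambda>i \<tau>. sem c (upd \<tau> x 0 i)) [0..<n] \<sigma>) x 0 n)"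
    using PFor ok sem_frame by (intro exec_for_loop) auto
  then obtain t where t: "t \<le> n * (?T + 2) + 1"
    "exec (While (Less (Cell x (N 0)) (Cell ''n'' (N 0)))
           (Seq (compile c) (Assign x (N 0) (Plus (Cell x (N 0)) (N 1)))))
      (upd \<sigma> x 0 0) t (sem (PFor x c) \<sigma>)"
    using PFor.prems by (auto simp: Let_def)
  have "exec (Assign x (N 0) (N 0)) \<sigma> 1 (upd \<sigma> x 0 0)"
    using exec.Assign[of x "N 0" "N 0" \<sigma>] by simp
  then have "exec (compile (PFor x c)) \<sigma> (1 + t) (sem (PFor x c) \<sigma>)"
    unfolding compile.simps using t(2) by (rule exec.Seq)
  moreover have "1 + t \<le> poly (time_poly (PFor x c)) n"
    using t(1) by (simp add: algebra_simps)
  ultimately show ?case by blast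
qed

text \<open>The proof rule for loops. \<open>stable\<close> makes the invariant blind to the counter
  cell, which is overwritten before each round and after the last. The step may also use that arrays
  not written by the loop still have their initial contents.\<close>

lemma sem_PFor_invariant:
  assumes "\<sigma> ''n'' 0 = n" "''n'' \<notin> writes (PFor x c)" "I 0 \<sigma>"
    and stable: "\<And>i j \<tau>. I i (upd \<tau> x 0 j) \<longleftrightarrow> I i \<tau>"
    and step: "\<And>i \<tau>. i < n \<Longrightarrow> \<tau> x 0 = i \<Longrightarrow> (\<And>z. z \<notin> writes (PFor x c) \<Longrightarrow> \<tau> z = \<sigma> z) \<Longrightarrow> I i \<tau> \<Longrightarrow>
        I (Suc i) (sem c \<tau>)"
  shows "I n (sem (PFor x c) \<sigma>)"
proof -
  define \<tau> where "\<tau> i = fold (\<lambda>i \<tau>. sem c (upd \<tau> x 0 i)) [0..<i] \<sigma>" for i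
  have "i \<le> n \<Longrightarrow> I i (\<tau> i) \<and> (\<forall>z. z \<notin> writes (PFor x c) \<longrightarrow> \<tau> i z = \<sigma> z)" for i
  proof (induction i)
    case 0
    show ?case using assms(3) by (simp add: \<tau>_def)
  next
    case (Suc i)
    have "\<tau> (Suc i) = sem c (upd (\<tau> i) x 0 i)" by (simp add: \<tau>_def)
    with Suc step[of i "upd (\<tau> i) x 0 i"] show ?case by (auto simp: stable sem_frame)
  qed
  from this[of n] have "I n (\<tau> n)" by simp
  then show ?thesis using assms(1) by (simp add: Let_def \<tau>_def stable)
qed

section \<open>Swap edges of a BFS tree\<close>

definition adj :: "'a set set \<Rightarrow> ('a \<times> 'a) set" where
  "adj A = {(u, v). {u, v} \<in> A}"

lemma is_path_relpow:
  assumes "is_path A u q v"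
  shows "(u, v) \<in> adj A ^^ (length q - 1)"
proof -
  have "successively (\<lambda>x y. {x, y} \<in> A) q \<Longrightarrow> q \<noteq> [] \<Longrightarrow> (hd q, last q) \<in> adj A ^^ (length q - 1)" for q
  proof (induction q rule: induct_list012)
    case (3 x y zs)
    then have "(x, y) \<in> adj A" "(y, last (y # zs)) \<in> adj A ^^ length zs"
      by (auto simp: adj_def)
    then show ?case using relpow_Suc_I2[of x y "adj A"] by simp
  qed auto
  with assms show ?thesis by (auto simp: is_path_def)
qed

lemma sym_adj_relpow: "(u, v) \<in> adj A ^^ k \<Longrightarrow> (v, u) \<in> adj A ^^ k"
proof (induction k arbitrary: u v)
  case (Suc k)
  then obtain w where "(u, w) \<in> adj A ^^ k" "(w, v) \<in> adj A" by auto
  then have "(w, u) \<in> adj A ^^ k" "(v, w) \<in> adj A"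
    using Suc.IH by (auto simp: adj_def insert_commute)
  then show ?case using relpow_Suc_I2 by metis
qed auto

lemma adj_relpow_mono: "(u, v) \<in> adj A ^^ k \<Longrightarrow> A \<subseteq> B \<Longrightarrow> (u, v) \<in> adj B ^^ k"
proof (induction k arbitrary: v)
  case (Suc k)
  then obtain w where "(u, w) \<in> adj A ^^ k" "(w, v) \<in> adj A" by auto
  with Suc show ?case by (auto simp: adj_def intro!: relpow_Suc_I)
qed auto

lemma relpow_trans:
  "(u, v) \<in> R ^^ k \<Longrightarrow> (v, w) \<in> R ^^ l \<Longrightarrow> (u, w) \<in> R ^^ (k + l)"
  by (auto simp: relpow_add)

text \<open>Walks compose and reverse freely, whereas \<open>gdist\<close> asks for distinct
  vertices. A walk of least length between its endpoints repeats no vertex.\<close>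

lemma relpow_is_path:
  assumes "(u, v) \<in> adj A ^^ k"
  obtains q where "is_path A u q v" "length q - 1 \<le> k"
proof -
  define l where "l = (LEAST l. (u, v) \<in> adj A ^^ l)"
  have l: "(u, v) \<in> adj A ^^ l" "l \<le> k"
    using assms unfolding l_def by (auto intro: LeastI Least_le)
  from l(1) obtain f where f: "f 0 = u" "f l = v" "\<And>i. i < l \<Longrightarrow> (f i, f (Suc i)) \<in> adj A"
    by (auto simp: relpow_fun_conv)
  have seg: "(f i, f (i + j)) \<in> adj A ^^ j" if "i + j \<le> l" for i j
    unfolding relpow_fun_conv using f that by (intro exI[of _ "\<lambda>k. f (i + k)"]) auto
  \<comment> \<open>Cutting out the closed part between two equal vertices would give a walk shorter
    than the least length \<open>l\<close>.\<close>
  have "f i \<noteq> f j" if "i < j" "j \<le> l" for i j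
  proof
    assume "f i = f j"
    with seg[of 0 i] seg[of j "l - j"] that f
    have "(u, v) \<in> adj A ^^ (i + (l - j))" by (intro relpow_trans[of u "f i"]) auto
    then have "l \<le> i + (l - j)" unfolding l_def by (rule Least_le)
    with that show False by simp
  qed
  then have inj: "inj_on f {0..<Suc l}"
    by (auto simp: inj_on_def linorder_neq_iff) (metis less_Suc_eq_le linorder_neqE_nat)
  have "is_path A u (map f [0..<Suc l]) v"
    unfolding is_path_def
  proof (intro conjI)
    show "hd (map f [0..<Suc l]) = u" using f by (simp add: hd_map del: upt_Suc)
    show "last (map f [0..<Suc l]) = v" using f by simp
    show "distinct (map f [0..<Suc l])" using inj by (simp add: distinct_map del: upt_Suc)
    show "successively (\<lambda>x y. {x, y} \<in> A) (map f [0..<Suc l])"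
      using f by (auto simp: successively_conv_nth adj_def simp del: upt_Suc)
  qed simp
  with l(2) show ?thesis by (intro that[of "map f [0..<Suc l]"]) auto
qed

lemma gdist_le_relpow:
  assumes "(u, v) \<in> adj A ^^ k"
  shows "gdist u v A \<le> enat k"
proof -
  obtain q where "is_path A u q v" "length q - 1 \<le> k" using relpow_is_path[OF assms] .
  then show ?thesis unfolding gdist_def by (intro INF_lower2[of q]) auto
qed

text \<open>A nonempty set of extended naturals contains its infimum, so a finite distance is
  attained by a path.\<close>

lemma gdist_finite_relpow:
  assumes "gdist u v A \<noteq> \<infinity>"
  obtains k where "gdist u v A = enat k" "(u, v) \<in> adj A ^^ k"
proof -
  let ?S = "(\<lambda>q. enat (length q - 1)) ` {q. is_path A u q v}"
  have "?S \<noteq> {}"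
  proof
    assume "?S = {}"
    then show False using assms unfolding gdist_def by (simp only: Inf_empty top_enat_def)
  qed
  then have "Inf ?S \<in> ?S" by (auto simp: Inf_enat_def intro: LeastI)
  then obtain q where q: "is_path A u q v" "gdist u v A = enat (length q - 1)"
    by (auto simp: gdist_def)
  show ?thesis using that[OF q(2) is_path_relpow[OF q(1)]] .
qed

text \<open>\<open>D\<close> is one plus the depth in the tree, with the value 0 marking the vertices that cannot be
  reached from \<open>s\<close>; the parent function \<open>p\<close> fixes those vertices and the root.\<close>

locale bfs_tree =
  fixes V :: "'a set" and E :: "'a set set" and s :: 'a and D :: "'a \<Rightarrow> nat" and p :: "'a \<Rightarrow> 'a"
  assumes graph: "simple_graph V E" and root_in: "s \<in> V"
    and D_root: "D s = 1" and p_root: "p s = s"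
    and parent: "\<And>v. v \<in> V \<Longrightarrow> v \<noteq> s \<Longrightarrow> 0 < D v \<Longrightarrow>
      p v \<in> V \<and> {p v, v} \<in> E \<and> 0 < D (p v) \<and> Suc (D (p v)) = D v"
    and unreached: "\<And>v. v \<in> V \<Longrightarrow> D v = 0 \<Longrightarrow> p v = v"
    and edge: "\<And>u v. {u, v} \<in> E \<Longrightarrow> 0 < D u \<Longrightarrow> 0 < D v \<and> D v \<le> Suc (D u)"
begin

section \<open>Subtrees, swap edges and labels along the tree\<close>

definition below :: "'a \<Rightarrow> 'a set" where
  "below y = {v. \<exists>k. (p ^^ k) v = y}"

definition swap_edge :: "'a \<Rightarrow> 'a \<Rightarrow> 'a \<Rightarrow> bool" where
  "swap_edge y a b \<longleftrightarrow> {a, b} \<in> E \<and> {a, b} \<noteq> {p y, y} \<and> a \<notin> below y \<and> b \<in> below y"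

text \<open>\<open>1 < D y\<close> singles out the reached vertices other than the root, those with
  a tree edge that can fail. Both labels exceed the depths by one, so minimising
  \<open>D a + D b\<close> minimises the sum of depths.\<close>

definition served :: "'a set set \<Rightarrow> 'a \<Rightarrow> bool" where
  "served H y \<longleftrightarrow> (1 < D y \<longrightarrow> {p y, y} \<in> H \<and> (\<forall>a b. swap_edge y a b \<longrightarrow>
     (\<exists>a' b'. swap_edge y a' b' \<and> {a', b'} \<in> H \<and> D a' + D b' \<le> D a + D b)))"

lemma served_mono: "served H y \<Longrightarrow> H \<subseteq> H' \<Longrightarrow> served H' y"
  unfolding served_def by blast

lemma edge_in: "{u, v} \<in> E \<Longrightarrow> u \<in> V \<and> v \<in> V \<and> u \<noteq> v"
  using graph unfolding simple_graph_def by (metis doubleton_eq_iff)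

lemma D_relpow:
  assumes "(u, v) \<in> adj E ^^ k" "0 < D u"
  shows "0 < D v \<and> D v \<le> D u + k"
  using assms
proof (induction k arbitrary: v)
  case (Suc k)
  then obtain w where "(u, w) \<in> adj E ^^ k" "{w, v} \<in> E" by (auto simp: adj_def)
  with Suc edge[of w v] show ?case by fastforce
qed auto

text \<open>A step up lowers the label by one as long as the label exceeds 1; \<open>k < D v\<close>
  stops the climb at the root at the latest.\<close>

lemma ancestor:
  assumes "v \<in> V" "k < D v"
  shows "(p ^^ k) v \<in> V \<and> D ((p ^^ k) v) = D v - k"
  using assms(2)
proof (induction k)
  case (Suc k)
  then have *: "(p ^^ k) v \<in> V" "D ((p ^^ k) v) = D v - k" by auto
  with Suc.prems D_root have "(p ^^ k) v \<noteq> s" by auto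
  with parent[OF *(1)] * Suc.prems show ?case by auto
qed (use assms in auto)

lemma D_one_root:
  assumes "v \<in> V" "D v = 1"
  shows "v = s"
  using parent[OF assms(1)] assms(2) by (cases "v = s") auto

lemma ancestor_root:
  assumes "v \<in> V" "0 < D v"
  shows "(p ^^ (D v - 1)) v = s"
  using ancestor[OF assms(1), of "D v - 1"] assms by (intro D_one_root) auto

lemma funpow_p_root: "(p ^^ k) s = s"
  by (induction k) (auto simp: p_root)

text \<open>A climb from an unreached vertex never moves, and after \<open>D v - 1\<close> steps a
  climb from a reached vertex stays at the root. As \<open>1 < D y\<close> excludes both as
  \<open>y\<close>, the climb meets \<open>y\<close> earlier.\<close>

lemma below_bounded:
  assumes "v \<in> V" "y \<in> V" "1 < D y" "(p ^^ k) v = y"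
  shows "k < D v \<and> D y = D v - k"
proof -
  have "0 < D v"
  proof (rule ccontr)
    assume "\<not> 0 < D v"
    then have "p v = v" using unreached assms by simp
    then have "(p ^^ k) v = v" by (induction k) auto
    with assms \<open>\<not> 0 < D v\<close> show False by simp
  qed
  have "k < D v"
  proof (rule ccontr)
    assume "\<not> k < D v"
    then have "(p ^^ k) v = (p ^^ (k - (D v - 1))) ((p ^^ (D v - 1)) v)"
      by (simp flip: comp_apply[of "p ^^ _"] funpow_add)
    also have "\<dots> = s" using ancestor_root[OF assms(1) \<open>0 < D v\<close>] funpow_p_root by simp
    finally show False using assms D_root by simp
  qed
  with ancestor[OF assms(1)] assms(4) show ?thesis by auto
qed

text \<open>Lets a loop of fixed length decide membership in a subtree.\<close>

lemma below_in_iff_bounded: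
  assumes "v \<in> V" "y \<in> V" "1 < D y" "D v \<le> n"
  shows "v \<in> below y \<longleftrightarrow> (\<exists>k\<le>n. (p ^^ k) v = y)"
  using below_bounded[OF assms(1-3)] assms(4) unfolding below_def
  by (auto dest: order.trans[OF less_imp_le])

lemma root_notin_below: "y \<noteq> s \<Longrightarrow> s \<notin> below y"
  by (auto simp: below_def funpow_p_root)

section \<open>Detours around a failing tree edge\<close>

lemma tree_walk:
  assumes v: "v \<in> V" "k < D v"
    and H: "\<And>w. w \<in> V \<Longrightarrow> 1 < D w \<Longrightarrow> {p w, w} \<in> H"
    and F: "\<And>j. j < k \<Longrightarrow> {p ((p ^^ j) v), (p ^^ j) v} \<notin> F"
  shows "((p ^^ k) v, v) \<in> adj (H - F) ^^ k"
proof -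
  have "(v, (p ^^ k) v) \<in> adj (H - F) ^^ k"
    unfolding relpow_fun_conv
  proof (intro exI[of _ "\<lambda>j. (p ^^ j) v"] conjI allI impI)
    fix j assume "j < k"
    with ancestor[of v j] v H[of "(p ^^ j) v"] F[of j]
    show "((p ^^ j) v, (p ^^ Suc j) v) \<in> adj (H - F)"
      by (auto simp: adj_def insert_commute)
  qed auto
  then show ?thesis by (rule sym_adj_relpow)
qed

text \<open>A tree edge determines its lower endpoint, the one with the larger label.\<close>

lemma tree_edge_eq_iff:
  assumes "y \<in> V" "1 < D y" "w \<in> V" "1 < D w"
  shows "{p w, w} = {p y, y} \<longleftrightarrow> w = y"
proof
  assume eq: "{p w, w} = {p y, y}"
  have "y \<noteq> s" "w \<noteq> s" using assms D_root by auto
  with parent[of y] parent[of w] assms have "D y = Suc (D (p y))" "D w = Suc (D (p w))" by auto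
  with eq show "w = y" by (auto simp: doubleton_eq_iff)
qed auto

text \<open>For a crossing edge \<open>(a, b)\<close> of a walk of length \<open>L\<close>, the part of the walk up to \<open>a\<close> and the
  part from \<open>b\<close> give \<open>D a + D b \<le> D v + L\<close>.\<close>

lemma crossing_edge:
  assumes "(s, v) \<in> adj (E - {{p y, y}}) ^^ L" "y \<noteq> s" "v \<in> below y"
  obtains a b where "swap_edge y a b" "D a + D b \<le> D v + L"
proof -
  let ?A = "E - {{p y, y}}"
  obtain f where f: "f 0 = s" "f L = v" "\<And>i. i < L \<Longrightarrow> (f i, f (Suc i)) \<in> adj ?A"
    using assms(1) by (auto simp: relpow_fun_conv)
  \<comment> \<open>The first vertex of the walk inside the subtree; the root lies outside, so it
    has a predecessor on the walk.\<close>
  define m where "m = (LEAST i. f i \<in> below y)"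
  have m: "f m \<in> below y" "m \<le> L"
    using assms(3) f(2) unfolding m_def by (auto intro: LeastI Least_le)
  have "m \<noteq> 0" using m(1) f(1) root_notin_below[OF assms(2)] by (cases m) auto
  then obtain i where i: "m = Suc i" by (cases m) auto
  have ni: "f i \<notin> below y" using i not_less_Least[of i "\<lambda>i. f i \<in> below y"] by (simp add: m_def)
  have iL: "i < L" using i m by simp
  have 1: "(s, f i) \<in> adj E ^^ i"
    unfolding relpow_fun_conv using f iL by (intro exI[of _ f]) (auto simp: adj_def)
  have 2: "(f m, v) \<in> adj E ^^ (L - m)"
    unfolding relpow_fun_conv using f m by (intro exI[of _ "\<lambda>k. f (m + k)"]) (auto simp: adj_def)
  have e: "{f i, f m} \<in> ?A" using f(3)[OF iL] i by (simp add: adj_def)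
  have a: "0 < D (f i) \<and> D (f i) \<le> 1 + i" using D_relpow[OF 1] D_root by simp
  have b: "0 < D (f m)" using edge[of "f i" "f m"] e a by simp
  then have "0 < D v" using D_relpow[OF 2] by simp
  then have "D (f m) \<le> D v + (L - m)" using D_relpow[OF sym_adj_relpow[OF 2]] by simp
  \<comment> \<open>The root label 1 contributes one unit, which the crossing edge compensates
    through \<open>m = Suc i\<close>.\<close>
  with a i m have "D (f i) + D (f m) \<le> D v + L" by linarith
  moreover have "swap_edge y (f i) (f m)" using e ni m by (auto simp: swap_edge_def)
  ultimately show ?thesis using that by blast
qed

text \<open>The failing edge is avoided on both sides: tree walks from \<open>y\<close> down use
  only edges whose lower endpoint has a label above \<open>D y\<close>, and the ancestors of
  \<open>a\<close> do not include \<open>y\<close>. The \<open>D a - 1\<close> tree edges to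
  \<open>a\<close> and the swap edge make up the summand \<open>D a\<close>.\<close>

lemma detour:
  assumes y: "y \<in> V" "1 < D y" and v: "v \<in> V" "v \<in> below y"
    and sw: "swap_edge y a b" "{a, b} \<in> H"
    and H: "\<And>w. w \<in> V \<Longrightarrow> 1 < D w \<Longrightarrow> {p w, w} \<in> H"
  shows "(s, v) \<in> adj (H - {{p y, y}}) ^^ (D a + (D b - D y) + (D v - D y))"
proof -
  let ?A = "H - {{p y, y}}"
  have ab: "a \<in> V" "b \<in> V" "a \<notin> below y" "b \<in> below y" "{a, b} \<in> E" "(a, b) \<in> adj ?A"
    using sw edge_in by (auto simp: swap_edge_def adj_def)
  have up: "(y, w) \<in> adj ?A ^^ (D w - D y) \<and> 0 < D w" if w: "w \<in> V" "w \<in> below y" for w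
  proof -
    obtain k where k: "(p ^^ k) w = y" using w by (auto simp: below_def)
    note kD = below_bounded[OF w(1) y k]
    have "((p ^^ k) w, w) \<in> adj ?A ^^ k"
    proof (intro tree_walk)
      fix j assume j: "j < k"
      with kD ancestor[of w j] w y have "(p ^^ j) w \<in> V" "D ((p ^^ j) w) > D y" by auto
      with tree_edge_eq_iff[OF y, of "(p ^^ j) w"] y
      show "{p ((p ^^ j) w), (p ^^ j) w} \<notin> {{p y, y}}" by auto
    qed (use w H kD in auto)
    with k kD show ?thesis by auto
  qed
  have "0 < D a" using edge[of b a] ab up by (auto simp: insert_commute)
  have "((p ^^ (D a - 1)) a, a) \<in> adj ?A ^^ (D a - 1)"
  proof (intro tree_walk)
    fix j assume j: "j < D a - 1"
    with ancestor[of a j] ab have "(p ^^ j) a \<in> V" "D ((p ^^ j) a) > 1" by auto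
    moreover have "(p ^^ j) a \<noteq> y" using ab by (auto simp: below_def)
    ultimately show "{p ((p ^^ j) a), (p ^^ j) a} \<notin> {{p y, y}}"
      using tree_edge_eq_iff[OF y] by auto
  qed (use ab H \<open>0 < D a\<close> in auto)
  then have "(s, a) \<in> adj ?A ^^ (D a - 1)"
    using ancestor_root ab \<open>0 < D a\<close> by simp
  then have "(s, b) \<in> adj ?A ^^ D a"
    using ab relpow_Suc_I[of s a "D a - 1"] \<open>0 < D a\<close> by simp
  from relpow_trans[OF this sym_adj_relpow]
  have "(s, y) \<in> adj ?A ^^ (D a + (D b - D y))" using up ab by blast
  from relpow_trans[OF this] show ?thesis using up v by blast
qed

lemma served_ft_abfs:
  assumes HE: "H \<subseteq> E" and served: "\<And>y. y \<in> V \<Longrightarrow> served H y"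
  shows "ft_abfs 1 3 0 V E s H"
  unfolding ft_abfs_def
proof (intro conjI ballI allI impI)
  have H: "{p w, w} \<in> H" if "w \<in> V" "1 < D w" for w
    using served[OF that(1)] that(2) by (simp add: served_def)
  fix v F assume v: "v \<in> V" and F: "F \<subseteq> E \<and> finite F \<and> card F \<le> 1"
  show "ereal_of_enat (gdist s v (H - F)) \<le> ereal 3 * ereal_of_enat (gdist s v (E - F)) + ereal 0"
  \<comment> \<open>If \<open>v\<close> is cut off from \<open>s\<close>, the right-hand side is
    infinite; only the finite case needs work.\<close>
  proof (cases "gdist s v (E - F) = \<infinity>")
    case False
    then obtain L where L: "gdist s v (E - F) = enat L" "(s, v) \<in> adj (E - F) ^^ L"
      by (rule gdist_finite_relpow)
    have "(s, v) \<in> adj E ^^ L" using adj_relpow_mono[OF L(2)] by auto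
    then have Dv: "0 < D v" "D v \<le> Suc L" using D_relpow[of s v L] D_root by auto
    have "\<exists>l\<le>3 * L. (s, v) \<in> adj (H - F) ^^ l"
    \<comment> \<open>If \<open>F\<close> misses the tree path to \<open>v\<close>, that path
      survives and is shortest. Otherwise \<open>F\<close> consists of exactly one edge of this
      path.\<close>
    proof (cases "\<exists>j < D v - 1. {p ((p ^^ j) v), (p ^^ j) v} \<in> F")
      case False
      then have "((p ^^ (D v - 1)) v, v) \<in> adj (H - F) ^^ (D v - 1)"
        using v Dv H by (intro tree_walk) auto
      then show ?thesis using Dv ancestor_root[OF v] by (intro exI[of _ "D v - 1"]) auto
    next
      case True
      then obtain j where j: "j < D v - 1" "{p ((p ^^ j) v), (p ^^ j) v} \<in> F" by blast
      define y where "y = (p ^^ j) v"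
      have "card F \<noteq> 0" using F j by auto
      then have "card F = 1" using F by linarith
      then have Fy: "F = {{p y, y}}" using j by (auto simp: y_def card_1_singleton_iff)
      have y: "y \<in> V" "D y = D v - j" "1 < D y"
        using ancestor[OF v, of j] j by (auto simp: y_def)
      have ys: "y \<noteq> s" using y D_root by auto
      have vy: "v \<in> below y" by (auto simp: below_def y_def)
      obtain a b where ab: "swap_edge y a b" "D a + D b \<le> D v + L"
        using crossing_edge[OF L(2)[unfolded Fy] ys vy] .
      obtain a' b' where ab': "swap_edge y a' b'" "{a', b'} \<in> H" "D a' + D b' \<le> D a + D b"
        using served[OF y(1)] y(3) ab(1) unfolding served_def by blast
      have "(s, v) \<in> adj (H - F) ^^ (D a' + (D b' - D y) + (D v - D y))"
        unfolding Fy using y(1,3) v vy ab'(1,2) H by (rule detour)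
      \<comment> \<open>After inserting \<open>D a' + D b' \<le> D v + L\<close>, the bound
        \<open>D v \<le> Suc L\<close> is used twice; \<open>1 < D y\<close> absorbs the two surplus
        units.\<close>
      moreover have "D a' + (D b' - D y) + (D v - D y) \<le> 3 * L"
        using ab ab' y Dv by linarith
      ultimately show ?thesis by blast
    qed
    then obtain l where l: "l \<le> 3 * L" "(s, v) \<in> adj (H - F) ^^ l"
      by blast
    from gdist_le_relpow[OF l(2)] have "gdist s v (H - F) \<le> enat (3 * L)"
      using l(1) by (rule order.trans[OF _ enat_ord_simps(1)[THEN iffD2]])
    then have "ereal_of_enat (gdist s v (H - F)) \<le> ereal_of_enat (enat (3 * L))"
      by (simp only: ereal_of_enat_le_iff)
    also have "\<dots> = ereal 3 * ereal_of_enat (enat L) + ereal 0" by simp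
    finally show ?thesis using L by simp
  qed simp
qed (fact HE)

end

section \<open>The algorithm\<close>

abbreviation Var :: "vname \<Rightarrow> aexp" where
  "Var x \<equiv> Cell x (N 0)"

definition Eq :: "aexp \<Rightarrow> aexp \<Rightarrow> bexp" where
  "Eq a b = And (Not (Less a b)) (Not (Less b a))"

lemma bval_Eq [simp]: "bval (Eq a b) \<sigma> \<longleftrightarrow> aval a \<sigma> = aval b \<sigma>"
  by (auto simp: Eq_def)

text \<open>The array \<open>r\<close> holds the row offsets \<open>r u = u * n\<close>, as the machine has no multiplication. The
  cells \<open>w\<close> and \<open>x\<close> climb from \<open>a\<close> and \<open>b\<close> until they meet \<open>y\<close>, which tests membership in the subtree
  of \<open>y\<close>; \<open>m\<close> is the cost of the best swap edge \<open>{e, f}\<close> so far, with 0 for none.\<close>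

definition init_prog :: prog where
  "init_prog =
    PSeq (PAssign ''d'' (Var ''s'') (N 1))
      (PFor ''i''
        (PSeq (PAssign ''r'' (Plus (Var ''i'') (N 1)) (Plus (Cell ''r'' (Var ''i'')) (Var ''n'')))
          (PAssign ''p'' (Var ''i'') (Var ''i''))))"

definition relax_prog :: prog where
  "relax_prog =
    PWhen (And (Eq (Cell ''d'' (Var ''u'')) (Plus (Var ''i'') (N 1)))
        (And (Less (N 0) (Cell ''adj'' (Plus (Cell ''r'' (Var ''u'')) (Var ''v''))))
          (Eq (Cell ''d'' (Var ''v'')) (N 0))))
      (PSeq (PAssign ''d'' (Var ''v'') (Plus (Cell ''d'' (Var ''u'')) (N 1)))
        (PAssign ''p'' (Var ''v'') (Var ''u'')))"

definition bfs_prog :: prog where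
  "bfs_prog = PFor ''i'' (PFor ''u'' (PFor ''v'' relax_prog))"

definition climb_prog :: "vname \<Rightarrow> prog" where
  "climb_prog x =
    PFor ''k'' (PWhen (Not (Eq (Var x) (Var ''y''))) (PAssign x (N 0) (Cell ''p'' (Var x))))"

text \<open>The last conjunct accepts an edge if none is recorded yet or if it is strictly cheaper
  than the recorded one.\<close>

definition better_cond :: bexp where
  "better_cond =
    And (Not (Eq (Var ''w'') (Var ''y''))) (And (Eq (Var ''x'') (Var ''y''))
    (And (Less (N 0) (Cell ''adj'' (Plus (Cell ''r'' (Var ''a'')) (Var ''b''))))
    (And (Not (And (Eq (Var ''a'') (Cell ''p'' (Var ''y''))) (Eq (Var ''b'') (Var ''y''))))
      (Not (And (Less (N 0) (Var ''m''))
        (Not (Less (Plus (Cell ''d'' (Var ''a'')) (Cell ''d'' (Var ''b''))) (Var ''m''))))))))"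

definition record_prog :: prog where
  "record_prog =
    PSeq (PAssign ''m'' (N 0) (Plus (Cell ''d'' (Var ''a'')) (Cell ''d'' (Var ''b''))))
    (PSeq (PAssign ''e'' (N 0) (Var ''a'')) (PAssign ''f'' (N 0) (Var ''b'')))"

definition compare_prog :: prog where
  "compare_prog =
    PSeq (PAssign ''w'' (N 0) (Var ''a'')) (PSeq (climb_prog ''w'')
    (PSeq (PAssign ''x'' (N 0) (Var ''b'')) (PSeq (climb_prog ''x'')
    (PWhen better_cond record_prog))))"

definition scan_prog :: prog where
  "scan_prog = PSeq (PAssign ''m'' (N 0) (N 0)) (PFor ''a'' (PFor ''b'' compare_prog))"

definition mark_prog :: prog where
  "mark_prog =
    PSeq (PAssign ''out'' (Plus (Cell ''r'' (Var ''e'')) (Var ''f'')) (N 1))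
      (PAssign ''out'' (Plus (Cell ''r'' (Var ''f'')) (Var ''e'')) (N 1))"

text \<open>The cells \<open>e\<close> and \<open>f\<close> serve twice: first they pass the tree
  edge to \<open>mark_prog\<close>, then the swap edge found by the scan.\<close>

definition vertex_prog :: prog where
  "vertex_prog = PWhen (Less (N 1) (Cell ''d'' (Var ''y'')))
    (PSeq (PAssign ''e'' (N 0) (Cell ''p'' (Var ''y'')))
    (PSeq (PAssign ''f'' (N 0) (Var ''y''))
    (PSeq mark_prog
    (PSeq scan_prog
      (PWhen (Less (N 0) (Var ''m'')) mark_prog)))))"

definition ft_prog :: prog where
  "ft_prog = PSeq init_prog (PSeq bfs_prog (PFor ''y'' vertex_prog))"

lemmas prog_defs = init_prog_def relax_prog_def bfs_prog_def climb_prog_def record_prog_def compare_prog_def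
  scan_prog_def mark_prog_def vertex_prog_def ft_prog_def

lemma loops_ok_ft_prog: "loops_ok ft_prog"
  by (simp add: prog_defs)

section \<open>Matrix indexing and initialisation\<close>

lemma div_mod_eq:
  fixes a b n :: nat
  assumes "b < n"
  shows "(a * n + b) div n = a" "(a * n + b) mod n = b"
  using assms by auto

lemma adj_array_at:
  assumes "a < n" "b < n"
  shows "adj_array n E (a * n + b) = of_bool ({a, b} \<in> E)"
proof -
  have "a * n + b < Suc a * n" using assms by simp
  also have "\<dots> \<le> n * n" using assms by (intro mult_le_mono1) simp
  finally show ?thesis using div_mod_eq[OF assms(2)] by (simp add: adj_array_def)
qed

lemma adj_array_insert:
  assumes "a < n" "b < n" "i < n * n"
  shows "((adj_array n H)(a * n + b := 1, b * n + a := 1)) i = adj_array n (insert {a, b} H) i"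
proof -
  have i: "i = i div n * n + i mod n" by simp
  have "i div n < n" "i mod n < n" using assms by (auto simp: less_mult_imp_div_less)
  have "{i div n, i mod n} = {a, b} \<longleftrightarrow> i = a * n + b \<or> i = b * n + a"
    using div_mod_eq assms i by (metis doubleton_eq_iff)
  then show ?thesis using assms by (auto simp: adj_array_def)
qed

definition env :: "nat \<Rightarrow> nat set set \<Rightarrow> state \<Rightarrow> bool" where
  "env n E \<sigma> \<longleftrightarrow> \<sigma> ''n'' 0 = n \<and> (\<forall>u<n. \<sigma> ''r'' u = u * n) \<and>
     (\<forall>u<n. \<forall>v<n. \<sigma> ''adj'' (u * n + v) = of_bool ({u, v} \<in> E))"

lemma sem_init_prog:
  fixes E :: "nat set set"
  assumes "s < n"
  defines "\<sigma> \<equiv> sem init_prog (graph_input n E s)"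
  shows "env n E \<sigma>" "\<sigma> ''d'' = (\<lambda>_. 0)(s := 1)" "\<forall>v<n. \<sigma> ''p'' v = v" "\<sigma> ''out'' = (\<lambda>_. 0)"
proof -
  let ?c = "PSeq (PAssign ''r'' (Plus (Var ''i'') (N 1)) (Plus (Cell ''r'' (Var ''i'')) (Var ''n'')))
          (PAssign ''p'' (Var ''i'') (Var ''i''))"
  let ?\<sigma> = "upd (graph_input n E s) ''d'' s 1"
  have \<sigma>: "\<sigma> = sem (PFor ''i'' ?c) ?\<sigma>"
    by (simp add: \<sigma>_def init_prog_def graph_input_def)
  have frame: "\<sigma> z = ?\<sigma> z" if "z \<notin> {''i'', ''r'', ''p''}" for z
    unfolding \<sigma> by (rule sem_frame) (use that in simp)
  \<comment> \<open>Round \<open>i\<close> writes \<open>r\<close> at \<open>i + 1\<close> but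
    \<open>p\<close> at \<open>i\<close>, hence the two different ranges; \<open>r 0 = 0\<close>
    comes from the zeroed memory.\<close>
  define I where "I i \<tau> \<longleftrightarrow> (\<forall>u\<le>i. \<tau> ''r'' u = u * n) \<and> (\<forall>u<i. \<tau> ''p'' u = u)" for i and \<tau> :: state
  have "I n \<sigma>"
    unfolding \<sigma>
  proof (rule sem_PFor_invariant)
    show "?\<sigma> ''n'' 0 = n" by (simp add: graph_input_def)
    show "I 0 ?\<sigma>" by (simp add: graph_input_def I_def)
    show "I (Suc i) (sem ?c \<tau>)" if "\<tau> ''i'' 0 = i" "I i \<tau>"
      "\<And>z. z \<notin> writes (PFor ''i'' ?c) \<Longrightarrow> \<tau> z = ?\<sigma> z" for i \<tau>
    proof -
      have "\<tau> ''n'' 0 = n" using that(3)[of "''n''"] by (simp add: graph_input_def)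
      with that(1,2) show ?thesis by (auto simp: I_def le_Suc_eq less_Suc_eq)
    qed
  qed (auto simp: I_def)
  then show "env n E \<sigma>" "\<forall>v<n. \<sigma> ''p'' v = v"
    using frame by (auto simp: env_def I_def graph_input_def adj_array_at)
  show "\<sigma> ''d'' = (\<lambda>_. 0)(s := 1)" "\<sigma> ''out'' = (\<lambda>_. 0)"
    using frame by (auto simp: graph_input_def)
qed

section \<open>Correctness of the breadth-first search\<close>

text \<open>The requirements of \<open>bfs_tree\<close> on labels and parents that hold throughout
  the search; the edge condition is established only gradually.\<close>

definition parent_forest ::
    "nat \<Rightarrow> nat set set \<Rightarrow> nat \<Rightarrow> (nat \<Rightarrow> nat) \<Rightarrow> (nat \<Rightarrow> nat) \<Rightarrow> bool" where
  "parent_forest n E s D p \<longleftrightarrow> D s = 1 \<and> p s = s \<and>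
    (\<forall>v<n. v \<noteq> s \<longrightarrow> 0 < D v \<longrightarrow> p v < n \<and> {p v, v} \<in> E \<and> 0 < D (p v) \<and> Suc (D (p v)) = D v) \<and>
    (\<forall>v<n. D v = 0 \<longrightarrow> p v = v)"

text \<open>Round \<open>k\<close> of the search scans the edges \<open>(u, v)\<close> with \<open>D u = k + 1\<close>; it has completed all
  \<open>u < i\<close>, and \<open>u = i\<close> for \<open>v < j\<close>.\<close>

definition bfs_inv ::
    "nat \<Rightarrow> nat set set \<Rightarrow> nat \<Rightarrow> nat \<Rightarrow> nat \<Rightarrow> nat \<Rightarrow> (nat \<Rightarrow> nat) \<Rightarrow> (nat \<Rightarrow> nat) \<Rightarrow> bool" where
  "bfs_inv n E s k i j D p \<longleftrightarrow> parent_forest n E s D p \<and> (\<forall>v<n. D v \<le> k + 2) \<and>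
    (\<forall>u v. {u, v} \<in> E \<longrightarrow> 0 < D u \<longrightarrow> D u \<le> k \<or> D u = Suc k \<and> (u < i \<or> u = i \<and> v < j) \<longrightarrow>
       0 < D v \<and> D v \<le> Suc (D u))"

lemma simple_graph_edge:
  assumes "simple_graph V E" "{u, v} \<in> E"
  shows "u \<in> V \<and> v \<in> V \<and> u \<noteq> v"
  using assms unfolding simple_graph_def by (metis doubleton_eq_iff)

text \<open>Serves to pass from the end of an inner loop to the next step of the outer one: no edge
  has an endpoint outside \<open>{0..<n}\<close>, so the same edges count as scanned.\<close>

lemma bfs_inv_mono:
  assumes "bfs_inv n E s k i j D p" "k \<le> k'"
    and "\<And>u v. {u, v} \<in> E \<Longrightarrow> D u \<le> k' \<or> D u = Suc k' \<and> (u < i' \<or> u = i' \<and> v < j') \<Longrightarrow>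
      D u \<le> k \<or> D u = Suc k \<and> (u < i \<or> u = i \<and> v < j)"
  shows "bfs_inv n E s k' i' j' D p"
proof -
  have "D v \<le> k' + 2" if "v < n" for v
    using assms(1,2) that unfolding bfs_inv_def by (meson add_le_mono1 order.trans)
  moreover have "0 < D v \<and> D v \<le> Suc (D u)"
    if "{u, v} \<in> E" "0 < D u" "D u \<le> k' \<or> D u = Suc k' \<and> (u < i' \<or> u = i' \<and> v < j')" for u v
    using assms(1) assms(3)[OF that(1,3)] that(1,2) unfolding bfs_inv_def by blast
  ultimately show ?thesis using assms(1) unfolding bfs_inv_def by blast
qed

lemma bfs_inv_relax:
  assumes inv: "bfs_inv n E s k i j (\<tau> ''d'') (\<tau> ''p'')" and "env n E \<tau>"
    and G: "simple_graph {0..<n} E" and "s < n"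
    and "i < n" and "j < n" and "\<tau> ''i'' 0 = k" "\<tau> ''u'' 0 = i" "\<tau> ''v'' 0 = j"
  shows "bfs_inv n E s k i (Suc j) (sem relax_prog \<tau> ''d'') (sem relax_prog \<tau> ''p'')"
proof -
  let ?D = "\<tau> ''d''" and ?p = "\<tau> ''p''"
  have adj: "0 < \<tau> ''adj'' (\<tau> ''r'' i + j) \<longleftrightarrow> {i, j} \<in> E"
    using assms by (simp add: env_def)
  have forest: "parent_forest n E s ?D ?p" and le: "\<And>v. v < n \<Longrightarrow> ?D v \<le> k + 2"
    using inv unfolding bfs_inv_def by blast+
  have scanned: "0 < ?D v \<and> ?D v \<le> Suc (?D u)"
    if "{u, v} \<in> E" "0 < ?D u" "?D u \<le> k \<or> ?D u = Suc k \<and> (u < i \<or> u = i \<and> v < j)" for u v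
    using inv that unfolding bfs_inv_def by blast
  show ?thesis
  proof (cases "?D i = Suc k \<and> {i, j} \<in> E \<and> ?D j = 0")
    case True
    let ?D' = "?D(j := Suc (?D i))" and ?p' = "?p(j := i)"
    have "i \<noteq> j" using True by auto
    \<comment> \<open>Parents of reached vertices have positive labels, so none of them is
      \<open>j\<close>, and their labels do not change.\<close>
    have "parent_forest n E s ?D' ?p'"
      using forest True \<open>i < n\<close> \<open>i \<noteq> j\<close> unfolding parent_forest_def by auto
    moreover have "?D' v \<le> k + 2" if "v < n" for v
      using le[OF that] True by simp
    moreover have "0 < ?D' v \<and> ?D' v \<le> Suc (?D' u)"
      if uv: "{u, v} \<in> E" "0 < ?D' u" "?D' u \<le> k \<or> ?D' u = Suc k \<and> (u < i \<or> u = i \<and> v < Suc j)" for u v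
    proof -
      \<comment> \<open>The new label of \<open>j\<close> is \<open>k + 2\<close>, too large for an
        edge leaving \<open>j\<close> to count as scanned.\<close>
      have "u \<noteq> j" using uv True by auto
      then show ?thesis using scanned[of u v] uv True by (cases "v = j") (auto simp: less_Suc_eq)
    qed
    ultimately have "bfs_inv n E s k i (Suc j) ?D' ?p'"
      unfolding bfs_inv_def by blast
    then show ?thesis
      using True adj assms(7-9) \<open>i \<noteq> j\<close> by (simp add: relax_prog_def)
  next
    case False
    then have eq: "sem relax_prog \<tau> = \<tau>"
      using adj assms(7-9) by (auto simp: relax_prog_def)
    have "0 < ?D v \<and> ?D v \<le> Suc (?D u)"
      if uv: "{u, v} \<in> E" "0 < ?D u" "?D u \<le> k \<or> ?D u = Suc k \<and> (u < i \<or> u = i \<and> v < Suc j)" for u v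
    \<comment> \<open>Only the pair \<open>(i, j)\<close> is new. Its second vertex is already
      labelled, and by the general bound its label is at most \<open>k + 2\<close>.\<close>
    proof (cases "u = i \<and> v = j \<and> ?D u = Suc k")
      case True
      with False uv le[OF \<open>j < n\<close>] show ?thesis by auto
    next
      case False
      with scanned[of u v] uv show ?thesis by (auto simp: less_Suc_eq)
    qed
    with forest le show ?thesis unfolding eq bfs_inv_def by blast
  qed
qed

lemma sem_bfs_prog:
  assumes "simple_graph {0..<n} E" "s < n" "env n E \<sigma>"
    and "\<sigma> ''d'' = (\<lambda>_. 0)(s := 1)" "\<forall>v<n. \<sigma> ''p'' v = v"
  shows "bfs_inv n E s n 0 0 (sem bfs_prog \<sigma> ''d'') (sem bfs_prog \<sigma> ''p'')"
proof -
  let ?I = "\<lambda>k i j \<tau>. bfs_inv n E s k i j (\<tau> ''d'') (\<tau> ''p'')"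
  note G = simple_graph_edge[OF assms(1)]
  have W: "writes relax_prog = {''d'', ''p''}" by (auto simp: relax_prog_def)
  show ?thesis
    unfolding bfs_prog_def
  proof (rule sem_PFor_invariant[where I = "\<lambda>k. ?I k 0 0"])
    show "?I 0 0 0 \<sigma>" using assms G by (auto simp: bfs_inv_def parent_forest_def)
    fix k \<tau> assume k: "k < n" "\<tau> ''i'' 0 = k" "?I k 0 0 \<tau>"
      "\<And>z. z \<notin> writes (PFor ''i'' (PFor ''u'' (PFor ''v'' relax_prog))) \<Longrightarrow> \<tau> z = \<sigma> z"
    have env: "env n E \<tau>" using assms(3) k(4) by (simp add: env_def W)
    have "?I k n 0 (sem (PFor ''u'' (PFor ''v'' relax_prog)) \<tau>)"
    proof (rule sem_PFor_invariant[where I = "\<lambda>i. ?I k i 0"])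
      show "?I k 0 0 \<tau>" by fact
      fix i \<tau>' assume i: "i < n" "\<tau>' ''u'' 0 = i" "?I k i 0 \<tau>'"
        "\<And>z. z \<notin> writes (PFor ''u'' (PFor ''v'' relax_prog)) \<Longrightarrow> \<tau>' z = \<tau> z"
      have env': "env n E \<tau>'" using env i(4) by (simp add: env_def W)
      have "?I k i n (sem (PFor ''v'' relax_prog) \<tau>')"
      proof (rule sem_PFor_invariant[where I = "?I k i"])
        show "?I k i 0 \<tau>'" by fact
        fix j \<tau>'' assume j: "j < n" "\<tau>'' ''v'' 0 = j" "?I k i j \<tau>''"
          "\<And>z. z \<notin> writes (PFor ''v'' relax_prog) \<Longrightarrow> \<tau>'' z = \<tau>' z"
        have "env n E \<tau>''" "\<tau>'' ''u'' 0 = i" "\<tau>'' ''i'' 0 = k"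
          using env' i j k by (simp_all add: env_def W)
        with bfs_inv_relax[OF j(3)] i j assms show "?I k i (Suc j) (sem relax_prog \<tau>'')"
          by simp
      qed (use env' in \<open>auto simp: env_def W\<close>)
      then show "?I k (Suc i) 0 (sem (PFor ''v'' relax_prog) \<tau>')"
        by (rule bfs_inv_mono) (auto dest: G simp: less_Suc_eq)
    qed (use env in \<open>auto simp: env_def W\<close>)
    then show "?I (Suc k) 0 0 (sem (PFor ''u'' (PFor ''v'' relax_prog)) \<tau>)"
      by (rule bfs_inv_mono) (auto dest: G simp: le_Suc_eq)
  qed (use assms in \<open>auto simp: env_def W\<close>)
qed

text \<open>Following parents from a vertex with label \<open>m\<close> yields all labels \<open>1, \<dots>, m\<close>, so there are at
  least \<open>m\<close> vertices.\<close>

lemma bfs_inv_label_le: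
  assumes "bfs_inv n E s k 0 0 D p" "v < n"
  shows "D v \<le> n"
proof -
  have "v < n \<Longrightarrow> D v = m \<Longrightarrow> {1..m} \<subseteq> D ` {0..<n}" for m v
  proof (induction m arbitrary: v)
    case (Suc m)
    have in_v: "Suc m \<in> D ` {0..<n}" using Suc.prems by force
    show ?case
    proof (cases "v = s")
      case True
      then show ?thesis using assms(1) Suc.prems in_v by (auto simp: bfs_inv_def parent_forest_def)
    next
      case False
      then have "p v < n" "D (p v) = m" using assms(1) Suc.prems by (auto simp: bfs_inv_def parent_forest_def)
      from Suc.IH[OF this] in_v show ?thesis by (simp add: atLeastAtMostSuc_conv)
    qed
  qed simp
  from card_mono[OF _ this[OF assms(2) refl]] show ?thesis
    using card_image_le[of "{0..<n}" D] by simp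
qed

text \<open>After \<open>n\<close> rounds every edge leaving a reached vertex has been scanned,
  because labels never exceed \<open>n\<close>.\<close>

lemma bfs_inv_imp_bfs_tree:
  assumes "simple_graph {0..<n} E" "s < n" "bfs_inv n E s n 0 0 D p"
  shows "bfs_tree {0..<n} E s D p"
proof
  fix u v assume "{u, v} \<in> E" "0 < D u"
  moreover have "D u \<le> n"
    using simple_graph_edge[OF assms(1) \<open>{u, v} \<in> E\<close>] bfs_inv_label_le[OF assms(3)] by simp
  ultimately show "0 < D v \<and> D v \<le> Suc (D u)" using assms(3) unfolding bfs_inv_def by blast
qed (use assms in \<open>auto simp: bfs_inv_def parent_forest_def\<close>)

section \<open>Testing subtree membership by climbing\<close>

lemma sem_climb_prog:
  assumes "x \<notin> {''k'', ''n'', ''y'', ''p''}" "\<sigma> ''n'' 0 = n"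
  shows "sem (climb_prog x) \<sigma> x 0 =
    ((\<lambda>w. if w = \<sigma> ''y'' 0 then w else \<sigma> ''p'' w) ^^ n) (\<sigma> x 0)"
    (is "_ = (?f ^^ n) _")
  unfolding climb_prog_def
proof (rule sem_PFor_invariant[where I = "\<lambda>i \<tau>. \<tau> x 0 = (?f ^^ i) (\<sigma> x 0)"])
  fix i \<tau>
  let ?c = "PWhen (Not (Eq (Var x) (Var ''y''))) (PAssign x (N 0) (Cell ''p'' (Var x)))"
  assume *: "\<tau> x 0 = (?f ^^ i) (\<sigma> x 0)" "\<And>z. z \<notin> writes (PFor ''k'' ?c) \<Longrightarrow> \<tau> z = \<sigma> z"
  have "\<tau> ''y'' = \<sigma> ''y''" "\<tau> ''p'' = \<sigma> ''p''" using *(2) assms by auto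
  then show "sem ?c \<tau> x 0 = (?f ^^ Suc i) (\<sigma> x 0)"
    using *(1) assms by auto
qed (use assms in auto)

text \<open>Once at \<open>y\<close> the stopped iteration stays there, so its final value records
  whether the climb has met \<open>y\<close> at all.\<close>

lemma funpow_stop_eq_iff:
  "((\<lambda>w. if w = y then w else p w) ^^ n) v = y \<longleftrightarrow> (\<exists>k\<le>n. (p ^^ k) v = y)"
proof (induction n arbitrary: v)
  case (Suc n)
  show ?case
  proof (cases "v = y")
    case True
    have "((\<lambda>w. if w = y then w else p w) ^^ m) y = y" for m by (induction m) auto
    with True show ?thesis by (metis funpow_0 le0)
  next
    case False
    have "(\<exists>k\<le>Suc n. (p ^^ k) v = y) \<longleftrightarrow> (\<exists>k\<le>n. (p ^^ k) (p v) = y)"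
    proof safe
      fix k assume "k \<le> Suc n" "y = (p ^^ k) v"
      with False show "\<exists>k'\<le>n. (p ^^ k') (p v) = (p ^^ k) v"
        by (cases k) (auto simp: funpow_Suc_right simp del: funpow.simps)
    next
      fix k assume "k \<le> n"
      then show "\<exists>k'\<le>Suc n. (p ^^ k') v = (p ^^ k) (p v)"
        by (intro exI[of _ "Suc k"]) (auto simp: funpow_Suc_right simp del: funpow.simps)
    qed
    with False Suc.IH[of "p v"] show ?thesis
      by (simp add: funpow_Suc_right del: funpow.simps)
  qed
qed simp

section \<open>Search for a cheapest swap edge\<close>

definition best_upto ::
    "(nat \<Rightarrow> nat \<Rightarrow> bool) \<Rightarrow> (nat \<Rightarrow> nat) \<Rightarrow> nat \<Rightarrow> nat \<Rightarrow> nat \<Rightarrow> nat \<Rightarrow> nat \<Rightarrow> bool" where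
  "best_upto C D i j m e f \<longleftrightarrow>
    (\<forall>a b. C a b \<longrightarrow> a < i \<or> a = i \<and> b < j \<longrightarrow> 0 < m \<and> m \<le> D a + D b) \<and>
    (0 < m \<longrightarrow> C e f \<and> m = D e + D f)"

locale bfs_run = bfs_tree "{0..<n}" E s D p for n :: nat and E s D p +
  assumes D_le: "v < n \<Longrightarrow> D v \<le> n"
begin

definition tree_env :: "state \<Rightarrow> bool" where
  "tree_env \<sigma> \<longleftrightarrow> env n E \<sigma> \<and> \<sigma> ''d'' = D \<and> \<sigma> ''p'' = p"

text \<open>Comparing \<open>{a, b}\<close> with \<open>{p y, y}\<close> in one orientation
  suffices: \<open>y\<close> lies in its own subtree and \<open>a\<close> does not, so
  \<open>a = y\<close> cannot occur.\<close>

lemma swap_edge_code: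
  assumes "a < n" "b < n" "y < n" "1 < D y"
  shows "swap_edge y a b \<longleftrightarrow>
    ((\<lambda>w. if w = y then w else p w) ^^ n) a \<noteq> y \<and> ((\<lambda>w. if w = y then w else p w) ^^ n) b = y \<and>
    {a, b} \<in> E \<and> \<not> (a = p y \<and> b = y)"
proof -
  have "y \<in> below y" by (auto simp: below_def intro: exI[of _ 0])
  moreover have "v \<in> below y \<longleftrightarrow> ((\<lambda>w. if w = y then w else p w) ^^ n) v = y" if "v < n" for v
    unfolding funpow_stop_eq_iff using below_in_iff_bounded[of v y n] that assms D_le by simp
  ultimately show ?thesis using assms(1,2) by (auto simp: swap_edge_def doubleton_eq_iff)
qed

text \<open>Justifies the value 0 of \<open>m\<close> as the mark for no edge found.\<close>

lemma swap_edge_D_pos: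
  assumes "y < n" "1 < D y" "swap_edge y a b"
  shows "0 < D a + D b"
proof -
  obtain k where "(p ^^ k) b = y" using assms(3) by (auto simp: swap_edge_def below_def)
  moreover have "b < n" using assms(3) edge_in[of a b] by (auto simp: swap_edge_def)
  ultimately have "k < D b" using below_bounded[of b y k] assms by auto
  then show ?thesis by simp
qed

lemma writes_climb_prog: "writes (climb_prog x) = {''k'', x}"
  by (auto simp: climb_prog_def)

lemma writes_compare_prog:
  "writes compare_prog = {''w'', ''x'', ''k'', ''m'', ''e'', ''f''}"
  by (auto simp: compare_prog_def climb_prog_def record_prog_def)

lemma best_upto_compare:
  assumes inv: "best_upto (swap_edge y) D a b (\<tau> ''m'' 0) (\<tau> ''e'' 0) (\<tau> ''f'' 0)"
    and env: "tree_env \<tau>" and "a < n" "b < n" and y: "y < n" "1 < D y"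
    and vals: "\<tau> ''y'' 0 = y" "\<tau> ''a'' 0 = a" "\<tau> ''b'' 0 = b"
  defines "\<tau>' \<equiv> sem compare_prog \<tau>"
  shows "best_upto (swap_edge y) D a (Suc b) (\<tau>' ''m'' 0) (\<tau>' ''e'' 0) (\<tau>' ''f'' 0)"
proof -
  let ?f = "\<lambda>w. if w = y then w else p w"
  define \<tau>1 where "\<tau>1 = sem (climb_prog ''w'') (upd \<tau> ''w'' 0 a)"
  define \<tau>2 where "\<tau>2 = sem (climb_prog ''x'') (upd \<tau>1 ''x'' 0 b)"
  have frame1: "\<tau>1 z = \<tau> z" if "z \<notin> {''k'', ''w''}" for z
    unfolding \<tau>1_def using that by (subst sem_frame) (auto simp: writes_climb_prog)
  have frame2: "\<tau>2 z = \<tau>1 z" if "z \<notin> {''k'', ''x''}" for z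
    unfolding \<tau>2_def using that by (subst sem_frame) (auto simp: writes_climb_prog)
  have "\<tau>1 ''w'' 0 = (?f ^^ n) a"
    unfolding \<tau>1_def using env vals by (subst sem_climb_prog[where n = n]) (auto simp: tree_env_def env_def cong: if_cong)
  then have w: "\<tau>2 ''w'' 0 = (?f ^^ n) a" using frame2 by simp
  have x: "\<tau>2 ''x'' 0 = (?f ^^ n) b"
    unfolding \<tau>2_def using env vals frame1
    by (subst sem_climb_prog[where n = n]) (auto simp: tree_env_def env_def cong: if_cong)
  have adj: "0 < \<tau>2 ''adj'' (\<tau>2 ''r'' a + b) \<longleftrightarrow> {a, b} \<in> E"
    using env frame1 frame2 assms(3,4) by (auto simp: tree_env_def env_def)
  have fr: "\<tau>2 ''y'' 0 = y" "\<tau>2 ''a'' 0 = a" "\<tau>2 ''b'' 0 = b" "\<tau>2 ''d'' = D" "\<tau>2 ''p'' = p"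
    "\<tau>2 ''m'' = \<tau> ''m''" "\<tau>2 ''e'' = \<tau> ''e''" "\<tau>2 ''f'' = \<tau> ''f''"
    using frame1 frame2 vals env by (auto simp: tree_env_def)
  let ?u = "upd (upd (upd \<tau>2 ''m'' 0 (D a + D b)) ''e'' 0 a) ''f'' 0 b"
  have cond: "bval better_cond \<tau>2 \<longleftrightarrow>
      swap_edge y a b \<and> \<not> (0 < \<tau> ''m'' 0 \<and> \<tau> ''m'' 0 \<le> D a + D b)"
    unfolding swap_edge_code[OF assms(3,4) y] better_cond_def
    by (simp add: w x adj fr not_less)
  have recorded: "sem record_prog \<tau>2 = ?u"
    by (simp add: record_prog_def fr)
  have "upd \<tau> ''w'' 0 a = sem (PAssign ''w'' (N 0) (Var ''a'')) \<tau>"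
    "upd \<tau>1 ''x'' 0 b = sem (PAssign ''x'' (N 0) (Var ''b'')) \<tau>1"
    using vals frame1 by simp_all
  then have \<tau>': "\<tau>' = (if bval better_cond \<tau>2 then sem record_prog \<tau>2 else \<tau>2)"
    unfolding \<tau>'_def compare_prog_def \<tau>2_def \<tau>1_def by simp
  show ?thesis
  proof (cases "bval better_cond \<tau>2")
    case True
    \<comment> \<open>Either \<open>m\<close> is 0 and no earlier pair is a swap edge, or the new
      cost undercuts \<open>m\<close> and with it all earlier candidates.\<close>
    then have "best_upto (swap_edge y) D a (Suc b) (D a + D b) a b"
      using inv swap_edge_D_pos[OF y] unfolding best_upto_def cond by (fastforce simp: less_Suc_eq)
    then show ?thesis using True by (simp add: \<tau>' recorded)
  next
    case False
    then have "best_upto (swap_edge y) D a (Suc b) (\<tau> ''m'' 0) (\<tau> ''e'' 0) (\<tau> ''f'' 0)"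
      using inv unfolding best_upto_def cond by (auto simp: less_Suc_eq)
    then show ?thesis using False by (simp add: \<tau>' fr)
  qed
qed

lemma best_upto_scan:
  assumes env: "tree_env \<tau>" and y: "y < n" "1 < D y" "\<tau> ''y'' 0 = y"
  defines "\<tau>' \<equiv> sem scan_prog \<tau>"
  shows "best_upto (swap_edge y) D n 0 (\<tau>' ''m'' 0) (\<tau>' ''e'' 0) (\<tau>' ''f'' 0)"
proof -
  let ?I = "\<lambda>i j \<tau>. best_upto (swap_edge y) D i j (\<tau> ''m'' 0) (\<tau> ''e'' 0) (\<tau> ''f'' 0)"
  let ?\<tau> = "upd \<tau> ''m'' 0 0"
  note W = writes_compare_prog
  have env0: "tree_env ?\<tau>" using env by (simp add: tree_env_def env_def)
  have "?I n 0 (sem (PFor ''a'' (PFor ''b'' compare_prog)) ?\<tau>)"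
  proof (rule sem_PFor_invariant[where I = "\<lambda>i. ?I i 0"])
    show "?I 0 0 ?\<tau>" by (simp add: best_upto_def)
    fix a \<tau>1 assume a: "a < n" "\<tau>1 ''a'' 0 = a" "?I a 0 \<tau>1"
      "\<And>z. z \<notin> writes (PFor ''a'' (PFor ''b'' compare_prog)) \<Longrightarrow> \<tau>1 z = ?\<tau> z"
    have env1: "tree_env \<tau>1" "\<tau>1 ''y'' 0 = y"
      using env0 y a(4) by (simp_all add: tree_env_def env_def W)
    have "?I a n (sem (PFor ''b'' compare_prog) \<tau>1)"
    proof (rule sem_PFor_invariant[where I = "?I a"])
      show "?I a 0 \<tau>1" by fact
      fix b \<tau>2 assume b: "b < n" "\<tau>2 ''b'' 0 = b" "?I a b \<tau>2"
        "\<And>z. z \<notin> writes (PFor ''b'' compare_prog) \<Longrightarrow> \<tau>2 z = \<tau>1 z"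
      have "tree_env \<tau>2" "\<tau>2 ''y'' 0 = y" "\<tau>2 ''a'' 0 = a"
        using env1 a b by (simp_all add: tree_env_def env_def W)
      with b a y show "?I a (Suc b) (sem compare_prog \<tau>2)"
        by (intro best_upto_compare) auto
    qed (use env1 in \<open>auto simp: tree_env_def env_def W\<close>)
    \<comment> \<open>Swap edges have both endpoints below \<open>n\<close>, so a full inner loop
      exhausts the candidates with first vertex \<open>a\<close>.\<close>
    moreover have "a' < n \<and> b' < n" if "swap_edge y a' b'" for a' b'
      using edge_in[of a' b'] that by (simp add: swap_edge_def)
    ultimately show "?I (Suc a) 0 (sem (PFor ''b'' compare_prog) \<tau>1)"
      unfolding best_upto_def less_Suc_eq by blast
  qed (use env0 in \<open>auto simp: tree_env_def env_def W\<close>)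
  then show ?thesis by (simp add: \<tau>'_def scan_prog_def)
qed

section \<open>Marking and counting the chosen edges\<close>

lemma sem_mark_prog:
  assumes "env n E \<sigma>" "\<sigma> ''e'' 0 < n" "\<sigma> ''f'' 0 < n" "outputs_graph \<sigma> n H"
  shows "outputs_graph (sem mark_prog \<sigma>) n (insert {\<sigma> ''e'' 0, \<sigma> ''f'' 0} H)"
  unfolding outputs_graph_def
proof (intro allI impI)
  fix i assume i: "i < n * n"
  let ?e = "\<sigma> ''e'' 0" and ?f = "\<sigma> ''f'' 0"
  have "sem mark_prog \<sigma> ''out'' i = ((adj_array n H)(?e * n + ?f := 1, ?f * n + ?e := 1)) i"
    using assms i by (simp add: mark_prog_def env_def outputs_graph_def)
  also have "\<dots> = adj_array n (insert {?e, ?f} H) i"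
    using assms(2,3) i by (rule adj_array_insert)
  finally show "sem mark_prog \<sigma> ''out'' i = \<dots>" .
qed

text \<open>The bound \<open>2 * y\<close> allows each processed vertex one tree edge and one swap
  edge; it becomes the linear size bound.\<close>

definition select_inv :: "nat \<Rightarrow> state \<Rightarrow> bool" where
  "select_inv y \<tau> \<longleftrightarrow> (\<exists>H. outputs_graph \<tau> n H \<and> H \<subseteq> E \<and> card H \<le> 2 * y \<and>
    (\<forall>w<y. served H w))"

lemma finite_E: "finite E"
proof (rule finite_subset)
  show "E \<subseteq> Pow {0..<n}" using graph by (auto simp: simple_graph_def)
qed simp

lemma select_inv_step:
  assumes inv: "select_inv y \<tau>" and env: "tree_env \<tau>" and y: "y < n" "\<tau> ''y'' 0 = y"
  shows "select_inv (Suc y) (sem vertex_prog \<tau>)"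
proof -
  obtain H where H: "outputs_graph \<tau> n H" "H \<subseteq> E" "card H \<le> 2 * y"
    "\<And>w. w < y \<Longrightarrow> served H w"
    using inv unfolding select_inv_def by blast
  show ?thesis
  \<comment> \<open>The root and the unreached vertices have no tree edge to protect and are served
    vacuously.\<close>
  proof (cases "1 < D y")
    case False
    then have "sem vertex_prog \<tau> = \<tau>" using env y by (simp add: vertex_prog_def tree_env_def)
    then show ?thesis using H False unfolding select_inv_def less_Suc_eq
      by (intro exI[of _ H]) (auto simp: served_def)
  next
    case True
    have "y \<noteq> s" using True D_root by auto
    then have py: "p y < n" "{p y, y} \<in> E" using parent[of y] y True by auto
    define \<tau>1 where "\<tau>1 = upd (upd \<tau> ''e'' 0 (p y)) ''f'' 0 y"
    define \<tau>2 where "\<tau>2 = sem mark_prog \<tau>1"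
    define \<tau>3 where "\<tau>3 = sem scan_prog \<tau>2"
    let ?H = "insert {p y, y} H"
    let ?e = "\<tau>3 ''e'' 0" and ?f = "\<tau>3 ''f'' 0" and ?m = "\<tau>3 ''m'' 0"
    have sem: "sem vertex_prog \<tau> = (if 0 < ?m then sem mark_prog \<tau>3 else \<tau>3)"
      using env y True
      by (simp add: vertex_prog_def tree_env_def \<tau>3_def \<tau>2_def \<tau>1_def)
    have "outputs_graph \<tau>1 n H" "env n E \<tau>1" "tree_env \<tau>1" "\<tau>1 ''y'' 0 = y"
      using H env y by (simp_all add: \<tau>1_def outputs_graph_def tree_env_def env_def)
    note \<tau>1 = this
    have frame2: "\<tau>2 z = \<tau>1 z" if "z \<noteq> ''out''" for z
      unfolding \<tau>2_def using that by (intro sem_frame) (simp add: mark_prog_def)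
    have frame3: "\<tau>3 z = \<tau>2 z" if "z \<notin> insert ''a'' (insert ''b'' (writes compare_prog))" for z
      unfolding \<tau>3_def using that
      by (intro sem_frame) (auto simp: scan_prog_def writes_compare_prog)
    have "outputs_graph \<tau>2 n ?H"
      using sem_mark_prog[of \<tau>1 H] \<tau>1 py y by (simp add: \<tau>2_def) (simp add: \<tau>1_def)
    then have out3: "outputs_graph \<tau>3 n ?H"
      using frame3[of "''out''"] by (simp add: outputs_graph_def writes_compare_prog)
    have env2: "tree_env \<tau>2" "\<tau>2 ''y'' 0 = y"
      using \<tau>1 frame2 by (simp_all add: tree_env_def env_def)
    have env3: "env n E \<tau>3"
      using env2 frame3 by (simp add: tree_env_def env_def writes_compare_prog)
    have best: "best_upto (swap_edge y) D n 0 ?m ?e ?f"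
      unfolding \<tau>3_def using env2 y True by (intro best_upto_scan) auto
    have bound: "a < n \<and> b < n \<and> {a, b} \<in> E" if "swap_edge y a b" for a b
      using edge_in[of a b] that by (simp add: swap_edge_def)
    have fin: "finite H" using H(2) finite_E finite_subset by blast
    then have card: "card ?H \<le> Suc (2 * y)" using H(3) by (simp add: card_insert_if)
    show ?thesis
    proof (cases "0 < ?m")
      case m: True
      then have ef: "swap_edge y ?e ?f" "?m = D ?e + D ?f"
        using best by (auto simp: best_upto_def)
      have out: "outputs_graph (sem vertex_prog \<tau>) n (insert {?e, ?f} ?H)"
        using m sem sem_mark_prog[OF env3 _ _ out3] bound[OF ef(1)] by simp
      have card': "card (insert {?e, ?f} ?H) \<le> 2 * Suc y"
        using card fin by (simp add: card_insert_if)
      have "D ?e + D ?f \<le> D a + D b" if "swap_edge y a b" for a b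
        using best bound[OF that] that ef(2) unfolding best_upto_def by metis
      then have "served (insert {?e, ?f} ?H) y"
        unfolding served_def using ef(1) by blast
      with H(4) have "served (insert {?e, ?f} ?H) w" if "w < Suc y" for w
        using that served_mono[of H w "insert {?e, ?f} ?H"] by (auto simp: less_Suc_eq)
      with out card' show ?thesis
        unfolding select_inv_def using H(2) bound[OF ef(1)] py by blast
    next
      case m: False
      \<comment> \<open>A completed scan that leaves \<open>m\<close> at 0 has met no candidate, so
        the tree edge alone serves \<open>y\<close>.\<close>
      then have "\<not> swap_edge y a b" for a b
        using best bound[of a b] unfolding best_upto_def by metis
      then have "served ?H y" by (simp add: served_def)
      with H(4) have "served ?H w" if "w < Suc y" for w
        using that served_mono[of H w ?H] by (auto simp: less_Suc_eq)
      moreover have "card ?H \<le> 2 * Suc y" using card by simp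
      ultimately show ?thesis
        unfolding select_inv_def using m sem out3 H(2) py by auto
    qed
  qed
qed

lemma sem_select:
  assumes "tree_env \<sigma>" "\<sigma> ''out'' = (\<lambda>_. 0)"
  shows "select_inv n (sem (PFor ''y'' vertex_prog) \<sigma>)"
proof (rule sem_PFor_invariant[where I = select_inv])
  have W: "writes vertex_prog = {''e'', ''f'', ''out'', ''m'', ''a'', ''b'', ''w'', ''x'', ''k''}"
    by (auto simp: prog_defs)
  show "\<sigma> ''n'' 0 = n" using assms by (simp add: tree_env_def env_def)
  show "''n'' \<notin> writes (PFor ''y'' vertex_prog)" by (simp add: W)
  show "select_inv 0 \<sigma>"
    unfolding select_inv_def using assms by (intro exI[of _ "{}"]) (simp add: outputs_graph_def adj_array_def)
  show "select_inv i (upd \<tau> ''y'' 0 j) \<longleftrightarrow> select_inv i \<tau>" for i j \<tau>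
    by (simp add: select_inv_def outputs_graph_def)
  fix y \<tau> assume y: "y < n" "\<tau> ''y'' 0 = y" "select_inv y \<tau>"
    "\<And>z. z \<notin> writes (PFor ''y'' vertex_prog) \<Longrightarrow> \<tau> z = \<sigma> z"
  then have "tree_env \<tau>" using assms(1) by (simp add: tree_env_def env_def W)
  with y show "select_inv (Suc y) (sem vertex_prog \<tau>)" by (intro select_inv_step)
qed

end

lemma sem_ft_prog:
  assumes "simple_graph {0..<n} E" "s < n"
  shows "\<exists>H. outputs_graph (sem ft_prog (graph_input n E s)) n H \<and>
    ft_abfs 1 3 0 {0..<n} E s H \<and> card H \<le> 2 * n"
proof -
  define \<sigma>1 where "\<sigma>1 = sem init_prog (graph_input n E s)"
  define \<sigma>2 where "\<sigma>2 = sem bfs_prog \<sigma>1"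
  note init = sem_init_prog[OF assms(2), of E, folded \<sigma>1_def]
  have inv: "bfs_inv n E s n 0 0 (\<sigma>2 ''d'') (\<sigma>2 ''p'')"
    unfolding \<sigma>2_def using assms init by (intro sem_bfs_prog) auto
  interpret bfs_run n E s "\<sigma>2 ''d''" "\<sigma>2 ''p''"
    using bfs_inv_imp_bfs_tree[OF assms inv] bfs_inv_label_le[OF inv]
    by (simp add: bfs_run_def bfs_run_axioms_def)
  have frame: "\<sigma>2 z = \<sigma>1 z" if "z \<notin> {''i'', ''u'', ''v'', ''d'', ''p''}" for z
    unfolding \<sigma>2_def using that by (intro sem_frame) (auto simp: bfs_prog_def relax_prog_def)
  have "tree_env \<sigma>2" "\<sigma>2 ''out'' = (\<lambda>_. 0)"
    using init frame by (auto simp: tree_env_def env_def)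
  from sem_select[OF this] obtain H where
    H: "outputs_graph (sem (PFor ''y'' vertex_prog) \<sigma>2) n H" "H \<subseteq> E" "card H \<le> 2 * n"
    "\<And>w. w < n \<Longrightarrow> served H w"
    unfolding select_inv_def by blast
  have "ft_abfs 1 3 0 {0..<n} E s H"
    using H(2,4) by (intro served_ft_abfs) auto
  moreover have "sem ft_prog (graph_input n E s) = sem (PFor ''y'' vertex_prog) \<sigma>2"
    by (simp add: ft_prog_def \<sigma>1_def \<sigma>2_def)
  ultimately show ?thesis using H by auto
qed

theorem theorem1:
  "\<exists>(P :: com) (p :: nat poly) (C :: nat).
     \<forall>(n :: nat) (E :: nat set set) (s :: nat).
       simple_graph {0..<n} E \<and> s \<in> {0..<n} \<longrightarrow>
       (\<exists>(t :: nat) (\<sigma> :: state) (H :: nat set set).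
          exec P (graph_input n E s) t \<sigma> \<and> t \<le> poly p n \<and>
          outputs_graph \<sigma> n H \<and>
          ft_abfs 1 3 0 {0..<n} E s H \<and>
          card H \<le> C * n)"
\<comment> \<open>The constant 2 counts the tree edge and the swap edge per vertex.\<close>
proof (rule exI[of _ "compile ft_prog"], rule exI[of _ "time_poly ft_prog"], rule exI[of _ 2],
    intro allI impI)
  fix n s :: nat and E assume *: "simple_graph {0..<n} E \<and> s \<in> {0..<n}"
  obtain t where "t \<le> poly (time_poly ft_prog) n"
    "exec (compile ft_prog) (graph_input n E s) t (sem ft_prog (graph_input n E s))"
    using exec_compile[OF loops_ok_ft_prog, of "graph_input n E s" n] by (auto simp: graph_input_def)
  moreover obtain H where "outputs_graph (sem ft_prog (graph_input n E s)) n H"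
    "ft_abfs 1 3 0 {0..<n} E s H" "card H \<le> 2 * n"
    using sem_ft_prog[of n E s] * by auto
  ultimately show "\<exists>t \<sigma> H. exec (compile ft_prog) (graph_input n E s) t \<sigma> \<and>
      t \<le> poly (time_poly ft_prog) n \<and> outputs_graph \<sigma> n H \<and>
      ft_abfs 1 3 0 {0..<n} E s H \<and> card H \<le> 2 * n"
    by blast
qed

end
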